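(* Let $K$ be a field of characteristic $\ne 2$ and let $N$ be an indecomposable associative nil evolution $K$-algebra of dimension $n\le 6$ with $\dim(\mathrm{ann}(N))=2$, written in a natural basis $\{e_i\}$ in one of the three normal forms $N_{5,9}(\alpha,\beta)$, $N_{6,17}(\alpha,\beta,\gamma)$, $N_{6,18}(\alpha,\beta,\gamma,\delta)$ listed in the context. Let $e_{ji}$ denote the endomorphism sending $e_i$ to $e_j$ and the other basis vectors to $0$. For $c=\sum_{i=1}^nc_ie_i\in N$, the map $R_c:x\mapsto xc$ is a derivation of $N$ if and only if it has the following form, and the space $\mathfrak{I}(N)$ of inner derivations is, as a vector space, as indicated: (1) $N_{5,9}(\alpha,\beta)$: $R_c=c_1e_{41}+c_2(\alpha e_{42}+\beta e_{52})+c_3e_{53}$; $\mathfrak{I}(N)\simeq K^3$. (2) $N_{6,17}(\alpha,\beta,\gamma)$: $R_c=c_1e_{51}+c_2(\alpha e_{52}+\beta e_{62})+c_3\gamma e_{63}+c_4e_{64}$; $\mathfrak{I}(N)\simeq K^4$. (3) $N_{6,18}(\alpha,\beta,\gamma,\delta)$: $R_c=c_1e_{51}+c_2(\alpha e_{52}+\beta e_{62})+c_3(\gamma e_{53}+\delta e_{63})+c_4e_{64}$; $\mathfrak{I}(N)\simeq K^4$.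
   Context: An evolution $K$-algebra is a finite-dimensional commutative (not necessarily associative) $K$-algebra with a basis $\{e_1,\dots,e_n\}$ (a natural basis) such that $e_ie_j=0$ for $i\neq j$. It is nil if for every $a$ some power $a^m$ is $0$; indecomposable if it is not a direct sum of two nonzero ideals; $\mathrm{ann}(N)=\{x\in N:xN=0\}$. A derivation of $N$ is a linear map $d:N\to N$ with $d(uv)=ud(v)+d(u)v$; $\mathfrak{D}(N)$ is the space of derivations. For a commutative associative algebra $N$, the space of inner derivations is $\mathfrak{I}(N)=\mathfrak{D}(N)\cap R(N)$, where $R(N)=\{R_c:c\in N\}$. Known classification (from earlier work, to be taken as given): every indecomposable associative nil evolution algebra of dimension $\le 6$ with $2$-dimensional annihilator is isomorphic to one of the following (products $e_ie_j$, $i\neq j$, are zero): - $N_{5,9}(\alpha,\beta)$: $e_1^2=e_4$, $e_2^2=\alpha e_4+\beta e_5$, $e_3^2=e_5$, $e_4^2=e_5^2=0$, with $\alpha,\beta\in K^*$. - $N_{6,17}(\alpha,\beta,\gamma)$: $e_1^2=e_5$, $e_2^2=\alpha e_5+\beta e_6$, $e_3^2=\gamma e_6$, $e_4^2=e_6$, $e_5^2=e_6^2=0$, with $\alpha\beta\gamma\ne0$. - $N_{6,18}(\alpha,\beta,\gamma,\delta)$: $e_1^2=e_5$, $e_2^2=\alpha e_5+\beta e_6$, $e_3^2=\gamma e_5+\delta e_6$, $e_4^2=e_6$, $e_5^2=e_6^2=0$, with $\alpha\beta\ne0$, $\gamma\delta\neq0$, $\alpha\delta-\beta\gamma\neq0$.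 *)

theory Defs
  imports "HOL-Analysis.Cartesian_Space" "HOL-Library.Function_Algebras"
begin

text \<open>
  An algebra is a whole type \<^typ>\<open>'a\<close> with a scalar multiplication and an explicit product.
\<close>

locale comm_algebra = vector_space smul
  for smul :: "'k::field \<Rightarrow> 'a::ab_group_add \<Rightarrow> 'a" +
  fixes mul :: "'a \<Rightarrow> 'a \<Rightarrow> 'a"
  assumes mul_linear: "Vector_Spaces.linear smul smul (mul x)"
    and mul_commute: "mul x y = mul y x"

definition associative_product :: "('a \<Rightarrow> 'a \<Rightarrow> 'a) \<Rightarrow> bool" where
  "associative_product mul \<longleftrightarrow> (\<forall>x y z. mul (mul x y) z = mul x (mul y z))"

text \<open>
  Principal powers, shifted by one since there is no unit:
  \<open>principal_power mul a m\<close> is \<open>a\<close> to the power \<open>m + 1\<close>.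
\<close>

primrec principal_power :: "('a \<Rightarrow> 'a \<Rightarrow> 'a) \<Rightarrow> 'a \<Rightarrow> nat \<Rightarrow> 'a" where
  "principal_power mul a 0 = a"
| "principal_power mul a (Suc m) = mul (principal_power mul a m) a"

definition nil_algebra :: "('a::zero \<Rightarrow> 'a \<Rightarrow> 'a) \<Rightarrow> bool" where
  "nil_algebra mul \<longleftrightarrow> (\<forall>a. \<exists>m. principal_power mul a m = 0)"

definition algebra_ideal ::
  "('k::field \<Rightarrow> 'a::ab_group_add \<Rightarrow> 'a) \<Rightarrow> ('a \<Rightarrow> 'a \<Rightarrow> 'a) \<Rightarrow> 'a set \<Rightarrow> bool" where
  "algebra_ideal smul mul I \<longleftrightarrow>
     module.subspace smul I \<and> (\<forall>a\<in>I. \<forall>x. mul a x \<in> I \<and> mul x a \<in> I)"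

definition indecomposable ::
  "('k::field \<Rightarrow> 'a::ab_group_add \<Rightarrow> 'a) \<Rightarrow> ('a \<Rightarrow> 'a \<Rightarrow> 'a) \<Rightarrow> bool" where
  "indecomposable smul mul \<longleftrightarrow>
     \<not> (\<exists>I J. algebra_ideal smul mul I \<and> algebra_ideal smul mul J \<and>
            I \<noteq> {0} \<and> J \<noteq> {0} \<and> I \<inter> J = {0} \<and> {x + y | x y. x \<in> I \<and> y \<in> J} = UNIV)"

definition annihilator :: "('a::zero \<Rightarrow> 'a \<Rightarrow> 'a) \<Rightarrow> 'a set" where
  "annihilator mul = {x. \<forall>y. mul x y = 0}"

definition natural_basis ::
  "('k::field \<Rightarrow> 'a::ab_group_add \<Rightarrow> 'a) \<Rightarrow> ('a \<Rightarrow> 'a \<Rightarrow> 'a) \<Rightarrow> nat \<Rightarrow> (nat \<Rightarrow> 'a) \<Rightarrow> bool" where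
  "natural_basis smul mul n e \<longleftrightarrow>
     inj_on e {1..n} \<and> \<not> module.dependent smul (e ` {1..n}) \<and>
     module.span smul (e ` {1..n}) = UNIV \<and>
     (\<forall>i\<in>{1..n}. \<forall>j\<in>{1..n}. i \<noteq> j \<longrightarrow> mul (e i) (e j) = 0)"

locale evolution_algebra = comm_algebra smul mul
  for smul :: "'k::field \<Rightarrow> 'a::ab_group_add \<Rightarrow> 'a" and mul :: "'a \<Rightarrow> 'a \<Rightarrow> 'a" +
  assumes ex_natural_basis: "\<exists>n e. natural_basis smul mul n e"

definition normal_form_N5_9 where
  "normal_form_N5_9 (smul :: 'k::field \<Rightarrow> 'a::ab_group_add \<Rightarrow> 'a) mul n (e :: nat \<Rightarrow> 'a) \<alpha> \<beta> \<longleftrightarrow>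
     n = 5 \<and> natural_basis smul mul n e \<and>
     \<alpha> \<noteq> 0 \<and> \<beta> \<noteq> 0 \<and>
     mul (e 1) (e 1) = e 4 \<and>
     mul (e 2) (e 2) = smul \<alpha> (e 4) + smul \<beta> (e 5) \<and>
     mul (e 3) (e 3) = e 5 \<and>
     mul (e 4) (e 4) = 0 \<and> mul (e 5) (e 5) = 0"

definition normal_form_N6_17 where
  "normal_form_N6_17 (smul :: 'k::field \<Rightarrow> 'a::ab_group_add \<Rightarrow> 'a) mul n (e :: nat \<Rightarrow> 'a) \<alpha> \<beta> \<gamma> \<longleftrightarrow>
     n = 6 \<and> natural_basis smul mul n e \<and>
     \<alpha> * \<beta> * \<gamma> \<noteq> 0 \<and>
     mul (e 1) (e 1) = e 5 \<and>
     mul (e 2) (e 2) = smul \<alpha> (e 5) + smul \<beta> (e 6) \<and>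
     mul (e 3) (e 3) = smul \<gamma> (e 6) \<and>
     mul (e 4) (e 4) = e 6 \<and>
     mul (e 5) (e 5) = 0 \<and> mul (e 6) (e 6) = 0"

definition normal_form_N6_18 where
  "normal_form_N6_18 (smul :: 'k::field \<Rightarrow> 'a::ab_group_add \<Rightarrow> 'a) mul n (e :: nat \<Rightarrow> 'a) \<alpha> \<beta> \<gamma> \<delta> \<longleftrightarrow>
     n = 6 \<and> natural_basis smul mul n e \<and>
     \<alpha> * \<beta> \<noteq> 0 \<and> \<gamma> * \<delta> \<noteq> 0 \<and> \<alpha> * \<delta> - \<beta> * \<gamma> \<noteq> 0 \<and>
     mul (e 1) (e 1) = e 5 \<and>
     mul (e 2) (e 2) = smul \<alpha> (e 5) + smul \<beta> (e 6) \<and>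
     mul (e 3) (e 3) = smul \<gamma> (e 5) + smul \<delta> (e 6) \<and>
     mul (e 4) (e 4) = e 6 \<and>
     mul (e 5) (e 5) = 0 \<and> mul (e 6) (e 6) = 0"

text \<open>
  Endomorphisms are functions; they are added by the pointwise instance of
  \<^class>\<open>ab_group_add\<close> on functions and scaled by \<open>fun_scale\<close>.
\<close>

definition fun_scale :: "('k \<Rightarrow> 'b \<Rightarrow> 'b) \<Rightarrow> 'k \<Rightarrow> ('a \<Rightarrow> 'b) \<Rightarrow> ('a \<Rightarrow> 'b)" where
  "fun_scale smul a f = (\<lambda>x. smul a (f x))"

definition derivations ::
  "('k::field \<Rightarrow> 'a::ab_group_add \<Rightarrow> 'a) \<Rightarrow> ('a \<Rightarrow> 'a \<Rightarrow> 'a) \<Rightarrow> ('a \<Rightarrow> 'a) set" where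
  "derivations smul mul =
     {d. Vector_Spaces.linear smul smul d \<and>
         (\<forall>u v. d (mul u v) = mul u (d v) + mul (d u) v)}"

definition right_mult :: "('a \<Rightarrow> 'a \<Rightarrow> 'a) \<Rightarrow> 'a \<Rightarrow> ('a \<Rightarrow> 'a)" where
  "right_mult mul c = (\<lambda>x. mul x c)"

definition inner_derivations ::
  "('k::field \<Rightarrow> 'a::ab_group_add \<Rightarrow> 'a) \<Rightarrow> ('a \<Rightarrow> 'a \<Rightarrow> 'a) \<Rightarrow> ('a \<Rightarrow> 'a) set" where
  "inner_derivations smul mul = derivations smul mul \<inter> range (right_mult mul)"

text \<open>
  \<open>unit_endo smul n e j i\<close> is the endomorphism \<open>e\<^sub>j\<^sub>i\<close>; note the order of the indices
  (target first).
\<close>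

definition unit_endo ::
  "('k::field \<Rightarrow> 'a::ab_group_add \<Rightarrow> 'a) \<Rightarrow> nat \<Rightarrow> (nat \<Rightarrow> 'a) \<Rightarrow> nat \<Rightarrow> nat \<Rightarrow> ('a \<Rightarrow> 'a)" where
  "unit_endo smul n e j i =
     vector_space_pair.construct smul smul (e ` {1..n}) (\<lambda>x. if x = e i then e j else 0)"

lemma (in comm_algebra) unit_endo:
  assumes "natural_basis smul mul n e"
  shows linear_unit_endo: "Vector_Spaces.linear smul smul (unit_endo smul n e j i)"
    and unit_endo_basis: "\<lbrakk>i \<in> {1..n}; k \<in> {1..n}\<rbrakk> \<Longrightarrow>
           unit_endo smul n e j i (e k) = (if k = i then e j else 0)"
proof -
  interpret vp: vector_space_pair smul smul ..
  have indep: "independent (e ` {1..n})" and inj: "inj_on e {1..n}"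
    using assms by (simp_all add: natural_basis_def)
  show "Vector_Spaces.linear smul smul (unit_endo smul n e j i)"
    unfolding unit_endo_def by (rule vp.linear_construct[OF indep])
  show "unit_endo smul n e j i (e k) = (if k = i then e j else 0)"
    if "i \<in> {1..n}" "k \<in> {1..n}"
    using that vp.construct_basis[OF indep, of "e k" "\<lambda>x. if x = e i then e j else 0"]
      inj_on_eq_iff[OF inj, of k i]
    by (simp add: unit_endo_def)
qed

definition subspaces_isomorphic ::
  "('k::field \<Rightarrow> 'a::ab_group_add \<Rightarrow> 'a) \<Rightarrow> 'a set \<Rightarrow>
   ('k \<Rightarrow> 'b::ab_group_add \<Rightarrow> 'b) \<Rightarrow> 'b set \<Rightarrow> bool" where
  "subspaces_isomorphic s1 V s2 W \<longleftrightarrow>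
     module.subspace s1 V \<and> module.subspace s2 W \<and>
     (\<exists>f. bij_betw f V W \<and>
          (\<forall>x\<in>V. \<forall>y\<in>V. f (x + y) = f x + f y) \<and>
          (\<forall>a. \<forall>x\<in>V. f (s1 a x) = s2 a (f x)))"

end

theory Submission
  imports Defs
begin

text \<open>
  Every associative nil evolution algebra satisfies \<open>N\<^sup>3 = 0\<close>. Indeed, for \<open>i \<noteq> j\<close> associativity gives
  \<open>e\<^sub>i\<^sup>2 e\<^sub>j = e\<^sub>i (e\<^sub>i e\<^sub>j) = 0\<close>, while \<open>e\<^sub>i\<^sup>2 e\<^sub>i = a e\<^sub>i\<^sup>2\<close>, where \<open>a\<close> is the coefficient of \<open>e\<^sub>i\<close> in \<open>e\<^sub>i\<^sup>2\<close>.
  Hence \<open>e\<^sub>i\<^bsup>m+2\<^esup> = a\<^sup>m e\<^sub>i\<^sup>2\<close>, and nilpotency of \<open>e\<^sub>i\<close> forces \<open>a = 0\<close> or \<open>e\<^sub>i\<^sup>2 = 0\<close>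
  (lemma \<open>square_mult_basis_eq_0\<close>). When triple products vanish, all three terms of the Leibniz
  rule for \<open>R\<^sub>c\<close> are zero, so \<^emph>\<open>every\<close> \<open>R\<^sub>c\<close> is a derivation.

  On the other side of the claimed equivalence, \<open>R\<^sub>c\<close> maps \<open>e\<^sub>k\<close> to \<open>c\<^sub>k e\<^sub>k\<^sup>2\<close>, and the displayed
  combination of the endomorphisms \<open>e\<^sub>j\<^sub>i\<close> does the same; so the displayed formula too holds for all \<open>c\<close>,
  and the equivalence is between two true assertions. Finally, the inner derivations
  are precisely the maps \<open>R\<^sub>c\<close>. Since \<open>R\<^sub>c\<close> determines exactly those coordinates \<open>c\<^sub>k\<close> with
  \<open>e\<^sub>k\<^sup>2 \<noteq> 0\<close>, their space has dimension the number of basis vectors with nonzero square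
  (lemma \<open>inner_derivations_isomorphic\<close>), which is three or four in the given normal forms.
\<close>

section \<open>Multiplication operators in a natural basis\<close>

locale natural_basis_algebra = comm_algebra smul mul
  for smul :: "'k::field \<Rightarrow> 'a::ab_group_add \<Rightarrow> 'a" and mul :: "'a \<Rightarrow> 'a \<Rightarrow> 'a" +
  fixes n :: nat and e :: "nat \<Rightarrow> 'a"
  assumes natural_basis: "natural_basis smul mul n e"
begin

sublocale endo: vector_space_pair smul smul ..

lemma linear_right_mult: "Vector_Spaces.linear smul smul (right_mult mul c)"
  using mul_linear[of c] by (simp add: right_mult_def mul_commute[of _ c])

lemma
  shows mul_sum_right: "mul x (\<Sum>i\<in>A. g i) = (\<Sum>i\<in>A. mul x (g i))"
    and mul_add_right: "mul x (y + z) = mul x y + mul x z"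
    and mul_smul_right: "mul x (smul a y) = smul a (mul x y)"
    and mul_0_right: "mul x 0 = 0"
  by (fact endo.linear_sum[OF mul_linear] endo.linear_add[OF mul_linear]
    endo.linear_scale[OF mul_linear] endo.linear_0[OF mul_linear])+

lemma basis_mult_eq_0: "\<lbrakk>i \<in> {1..n}; j \<in> {1..n}; i \<noteq> j\<rbrakk> \<Longrightarrow> mul (e i) (e j) = 0"
  and span_basis: "span (e ` {1..n}) = UNIV"
  and basis_inj: "inj_on e {1..n}"
  and basis_independent: "independent (e ` {1..n})"
  using natural_basis by (auto simp: natural_basis_def)

lemma basis_nonzero: "i \<in> {1..n} \<Longrightarrow> e i \<noteq> 0"
  using basis_independent dependent_zero[of "e ` {1..n}"] by force

lemma basis_expansion:
  obtains c where "x = (\<Sum>i=1..n. smul (c i) (e i))"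
proof -
  have "x \<in> span (e ` {1..n})"
    using span_basis by simp
  then obtain u where "x = (\<Sum>v\<in>e ` {1..n}. smul (u v) v)"
    by (auto simp: span_finite)
  then have "x = (\<Sum>i=1..n. smul (u (e i)) (e i))"
    by (simp only: sum.reindex[OF basis_inj] o_def)
  then show ?thesis
    by (rule that)
qed

lemma linear_eq_on_basis:
  assumes "Vector_Spaces.linear smul smul f" "Vector_Spaces.linear smul smul g"
    and "\<And>k. k \<in> {1..n} \<Longrightarrow> f (e k) = g (e k)"
  shows "f = g"
proof
  show "f x = g x" for x
    by (rule endo.linear_eq_on[OF assms(1,2), of x "e ` {1..n}"]) (use assms(3) span_basis in auto)
qed

lemma basis_mult:
  assumes "k \<in> {1..n}"
  shows "mul (e k) (\<Sum>i=1..n. smul (c i) (e i)) = smul (c k) (mul (e k) (e k))"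
proof -
  have "mul (e k) (\<Sum>i=1..n. smul (c i) (e i)) = (\<Sum>i=1..n. smul (c i) (mul (e k) (e i)))"
    by (simp add: mul_sum_right mul_smul_right)
  also have "\<dots> = (\<Sum>i=1..n. if i = k then smul (c k) (mul (e k) (e k)) else 0)"
    using assms by (intro sum.cong) (auto simp: basis_mult_eq_0)
  also have "\<dots> = smul (c k) (mul (e k) (e k))"
    using assms by simp
  finally show ?thesis .
qed

lemma mult_basis_eq_0_of_square:
  assumes "k \<in> {1..n}" "mul (e k) (e k) = 0"
  shows "mul y (e k) = 0"
proof -
  obtain c where "y = (\<Sum>i=1..n. smul (c i) (e i))"
    by (rule basis_expansion)
  then have "mul (e k) y = 0"
    using basis_mult[OF assms(1), of c] assms(2) by simp
  then show ?thesis
    by (simp add: mul_commute[of y])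
qed

lemma right_mult_eqI:
  assumes "Vector_Spaces.linear smul smul d"
    and "\<And>k. k \<in> {1..n} \<Longrightarrow> d (e k) = smul (c k) (mul (e k) (e k))"
  shows "right_mult mul (\<Sum>i=1..n. smul (c i) (e i)) = d"
  by (rule linear_eq_on_basis[OF linear_right_mult assms(1)])
    (use assms(2) basis_mult in \<open>simp add: right_mult_def\<close>)

lemma linear_fun_scale:
  "Vector_Spaces.linear smul smul d \<Longrightarrow> Vector_Spaces.linear smul smul (fun_scale smul a d)"
  unfolding fun_scale_def by (rule endo.linear_compose_scale_right)

lemma linear_plus:
  "\<lbrakk>Vector_Spaces.linear smul smul d; Vector_Spaces.linear smul smul d'\<rbrakk> \<Longrightarrow>
    Vector_Spaces.linear smul smul (d + d')"
  unfolding plus_fun_def by (rule endo.linear_compose_add)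

lemma smul_basis_add_nonzero:
  assumes "i \<in> {1..n}" "j \<in> {1..n}" "i \<noteq> j" "a \<noteq> 0"
  shows "smul a (e i) + smul b (e j) \<noteq> 0"
proof
  \<comment> \<open>The projection \<open>e\<^sub>i\<^sub>i\<close> isolates the first summand.\<close>
  let ?p = "unit_endo smul n e i i"
  note lin = linear_unit_endo[OF natural_basis, of i i]
  assume "smul a (e i) + smul b (e j) = 0"
  then have "?p (smul a (e i) + smul b (e j)) = 0"
    using endo.linear_0[OF lin] by simp
  then have "smul a (e i) = 0"
    using assms by (simp add: endo.linear_add[OF lin] endo.linear_scale[OF lin]
        unit_endo_basis[OF natural_basis])
  then show False
    using assms basis_nonzero by simp
qed

lemma module_fun_scale: "module (fun_scale smul :: 'k \<Rightarrow> ('b \<Rightarrow> 'a) \<Rightarrow> 'b \<Rightarrow> 'a)"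
  by unfold_locales
    (auto simp: fun_scale_def fun_eq_iff scale_right_distrib scale_left_distrib)

end

section \<open>Vanishing of triple products\<close>

locale associative_nil_evolution_algebra = natural_basis_algebra smul mul n e
  for smul :: "'k::field \<Rightarrow> 'a::ab_group_add \<Rightarrow> 'a" and mul n e +
  assumes assoc: "associative_product mul" and nil: "nil_algebra mul"
begin

text \<open>
  The powers of \<open>e\<^sub>i\<close> beyond the square are scalar multiples of \<open>e\<^sub>i\<^sup>2\<close>, by powers of one and the same
  scalar; that scalar must be zero unless \<open>e\<^sub>i\<^sup>2\<close> already is.
\<close>

lemma square_mult_basis_eq_0:
  assumes i: "i \<in> {1..n}" and j: "j \<in> {1..n}"
  shows "mul (mul (e i) (e i)) (e j) = 0"
proof (cases "i = j")
  case False
  then show ?thesis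
    using assoc i j by (simp add: associative_product_def basis_mult_eq_0 mul_0_right)
next
  case True
  obtain c where c: "mul (e i) (e i) = (\<Sum>k=1..n. smul (c k) (e k))"
    by (rule basis_expansion)
  have cube: "mul (mul (e i) (e i)) (e i) = smul (c i) (mul (e i) (e i))"
    using basis_mult[OF i, of c, folded c] by (simp add: mul_commute[of "mul (e i) (e i)"])
  have power: "principal_power mul (e i) (Suc m) = smul (c i ^ m) (mul (e i) (e i))" for m
  proof (induction m)
    case 0
    show ?case by simp
  next
    case (Suc m)
    have "principal_power mul (e i) (Suc (Suc m)) = mul (smul (c i ^ m) (mul (e i) (e i))) (e i)"
      using Suc by simp
    also have "\<dots> = smul (c i ^ m) (mul (mul (e i) (e i)) (e i))"
      by (metis mul_commute mul_smul_right)
    finally show ?case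
      by (simp add: cube mult.commute)
  qed
  obtain m where m: "principal_power mul (e i) m = 0"
    using nil by (auto simp: nil_algebra_def)
  then obtain m' where "m = Suc m'"
    using basis_nonzero[OF i] by (cases m) auto
  then have "c i = 0 \<or> mul (e i) (e i) = 0"
    using m power[of m'] by auto
  then show ?thesis
    using True cube by auto
qed

lemma triple_product_eq_0: "mul (mul x y) z = 0"
proof -
  \<comment> \<open>Since \<open>(x y) e\<^sub>k = x (y e\<^sub>k)\<close> is a multiple of \<open>x e\<^sub>k\<^sup>2\<close>, it is enough that the squares \<open>e\<^sub>k\<^sup>2\<close>
    annihilate the algebra.\<close>
  have basis_square: "mul (mul (e k) (e k)) w = 0" if "k \<in> {1..n}" for k w
  proof -
    obtain c where "w = (\<Sum>i=1..n. smul (c i) (e i))"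
      by (rule basis_expansion)
    then show ?thesis
      using that by (simp add: mul_sum_right mul_smul_right square_mult_basis_eq_0)
  qed
  have "mul (mul x y) (e k) = 0" if k: "k \<in> {1..n}" for k
  proof -
    obtain c where "y = (\<Sum>i=1..n. smul (c i) (e i))"
      by (rule basis_expansion)
    then have "mul (e k) y = smul (c k) (mul (e k) (e k))"
      using basis_mult[OF k] by simp
    moreover have "mul (mul x y) (e k) = mul x (mul (e k) y)"
      using assoc by (simp add: associative_product_def mul_commute[of "e k" y])
    moreover have "mul x (mul (e k) (e k)) = 0"
      using basis_square[OF k, of x] by (simp add: mul_commute[of x "mul (e k) (e k)"])
    ultimately show ?thesis
      by (simp add: mul_smul_right)
  qed
  moreover obtain c where "z = (\<Sum>i=1..n. smul (c i) (e i))"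
    by (rule basis_expansion)
  ultimately show ?thesis
    by (simp add: mul_sum_right mul_smul_right)
qed

section \<open>The space of inner derivations\<close>

lemma right_mult_derivation: "right_mult mul c \<in> derivations smul mul"
proof -
  have "mul x (mul y z) = 0" for x y z
    using assoc triple_product_eq_0 by (simp add: associative_product_def)
  then show ?thesis
    using linear_right_mult[of c] triple_product_eq_0
    by (simp add: derivations_def right_mult_def)
qed

lemma inner_derivations_eq: "inner_derivations smul mul = range (right_mult mul)"
  by (auto simp: inner_derivations_def right_mult_derivation)

text \<open>
  Since \<open>R\<^sub>c\<close> sends \<open>e\<^sub>k\<close> to \<open>c\<^sub>k e\<^sub>k\<^sup>2\<close>, it records \<open>c\<^sub>k\<close> when \<open>e\<^sub>k\<^sup>2 \<noteq> 0\<close> and forgets it otherwise. Restricting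
  \<open>c\<close> to the span of the \<open>e\<^sub>k\<close> of the first kind therefore gives coordinates on the inner derivations.
\<close>

lemma inner_derivations_isomorphic:
  assumes card: "card {k\<in>{1..n}. mul (e k) (e k) \<noteq> 0} = CARD('m::finite)"
  shows "subspaces_isomorphic (fun_scale smul) (inner_derivations smul mul)
           (*s) (UNIV :: ('k ^ 'm) set)"
proof -
  let ?S = "{k\<in>{1..n}. mul (e k) (e k) \<noteq> 0}"
  obtain h :: "'m \<Rightarrow> nat" where h: "bij_betw h UNIV ?S"
    using finite_same_card_bij[of "UNIV :: 'm set" ?S] card by auto
  have hS: "h k \<in> {1..n}" "mul (e (h k)) (e (h k)) \<noteq> 0" for k
    using bij_betwE[OF h] by auto
  have h_inj: "h j = h k \<longleftrightarrow> j = k" for j k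
    using h by (auto simp: bij_betw_def inj_on_def)
  define g :: "'k ^ 'm \<Rightarrow> 'a \<Rightarrow> 'a"
    where "g v = right_mult mul (\<Sum>k\<in>UNIV. smul (v $ k) (e (h k)))" for v
  have g_apply: "g v y = (\<Sum>k\<in>UNIV. smul (v $ k) (mul y (e (h k))))" for v y
    by (simp add: g_def right_mult_def mul_sum_right mul_smul_right)
  have g_add: "g (v + w) = g v + g w" for v w
    by (simp add: fun_eq_iff g_apply scale_left_distrib sum.distrib)
  have g_scale: "g (a *s v) = fun_scale smul a (g v)" for a v
    by (simp add: fun_eq_iff g_apply fun_scale_def scale_sum_right)
  have g_basis: "g v (e (h k)) = smul (v $ k) (mul (e (h k)) (e (h k)))" for v k
  proof -
    have "g v (e (h k)) =
        (\<Sum>j\<in>UNIV. if j = k then smul (v $ k) (mul (e (h k)) (e (h k))) else 0)"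
      unfolding g_apply
    proof (intro sum.cong refl)
      show "smul (v $ j) (mul (e (h k)) (e (h j))) =
          (if j = k then smul (v $ k) (mul (e (h k)) (e (h k))) else 0)" for j
        using basis_mult_eq_0[of "h k" "h j"] hS h_inj[of k j] by auto
    qed
    then show ?thesis by simp
  qed
  have "inj g"
  proof
    fix v w assume "g v = g w"
    then have "smul (v $ k) (mul (e (h k)) (e (h k))) = smul (w $ k) (mul (e (h k)) (e (h k)))" for k
      using g_basis by metis
    then show "v = w"
      using hS by (simp add: vec_eq_iff)
  qed
  have "right_mult mul x \<in> range g" for x
  proof -
    obtain c where x: "x = (\<Sum>i=1..n. smul (c i) (e i))"
      by (rule basis_expansion)
    have "right_mult mul x y = g (\<chi> k. c (h k)) y" for y
    proof -
      have "right_mult mul x y = (\<Sum>i=1..n. smul (c i) (mul y (e i)))"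
        by (simp add: x right_mult_def mul_sum_right mul_smul_right)
      also have "\<dots> = (\<Sum>i\<in>?S. smul (c i) (mul y (e i)))"
        by (intro sum.mono_neutral_right) (auto simp: mult_basis_eq_0_of_square)
      also have "\<dots> = g (\<chi> k. c (h k)) y"
        using sum.reindex_bij_betw[OF h, of "\<lambda>i. smul (c i) (mul y (e i))"]
        by (simp add: g_apply)
      finally show ?thesis .
    qed
    then show ?thesis
      by blast
  qed
  then have range_g: "range g = inner_derivations smul mul"
    unfolding inner_derivations_eq by (auto simp: g_def)
  have inv_g: "inv g (g v) = v" for v
    using \<open>inj g\<close> by simp
  have "module.subspace (fun_scale smul) (range g)"
    unfolding module.subspace_def[OF module_fun_scale]
  proof (intro conjI ballI allI)
    have "g 0 = 0"
      by (simp add: fun_eq_iff g_apply)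
    then show "0 \<in> range g"
      by (metis rangeI)
  qed (auto simp flip: g_add g_scale)
  moreover have "module.subspace (*s) (UNIV :: ('k ^ 'm) set)"
    by (rule vec.subspace_UNIV)
  moreover have "bij_betw (inv g) (range g) UNIV"
    using \<open>inj g\<close> by (simp add: bij_betw_inv_into inj_on_imp_bij_betw)
  ultimately show ?thesis
    unfolding subspaces_isomorphic_def range_g[symmetric]
    by (intro conjI exI[of _ "inv g"]) (auto simp: inv_g simp flip: g_add g_scale)
qed

section \<open>The normal forms\<close>

text \<open>
  In each normal form the formula for \<open>R\<^sub>c\<close> is checked on the basis vectors, and the dimension is
  found by counting those with nonzero square. A square with two terms, such as
  \<open>\<alpha> e\<^sub>4 + \<beta> e\<^sub>5\<close>, is nonzero because its first coefficient is.
\<close>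

lemma
  assumes nf: "normal_form_N5_9 smul mul n e \<alpha> \<beta>"
  shows right_mult_N5_9: "right_mult mul (\<Sum>i=1..n. smul (c i) (e i)) =
      fun_scale smul (c 1) (unit_endo smul n e 4 1) +
        fun_scale smul (c 2)
          (fun_scale smul \<alpha> (unit_endo smul n e 4 2) +
           fun_scale smul \<beta> (unit_endo smul n e 5 2)) +
        fun_scale smul (c 3) (unit_endo smul n e 5 3)" (is "_ = ?d")
    and inner_derivations_N5_9:
      "subspaces_isomorphic (fun_scale smul) (inner_derivations smul mul)
         (*s) (UNIV :: ('k ^ 3) set)"
proof -
  have n: "n = 5"
    using nf by (simp add: normal_form_N5_9_def)
  have range: "k = 1 \<or> k = 2 \<or> k = 3 \<or> k = 4 \<or> k = 5" if "k \<in> {1..n}" for k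
    using that unfolding n atLeastAtMost_iff by arith
  note unit_endo = unit_endo_basis[OF natural_basis, unfolded n]
  show "right_mult mul (\<Sum>i=1..n. smul (c i) (e i)) = ?d"
  proof (rule right_mult_eqI)
    show "?d (e k) = smul (c k) (mul (e k) (e k))" if "k \<in> {1..n}" for k
      using range[OF that]
      by (elim disjE)
        (use nf in \<open>simp_all add: normal_form_N5_9_def plus_fun_def fun_scale_def
          unit_endo scale_right_distrib\<close>)
  qed (intro linear_plus linear_fun_scale linear_unit_endo[OF natural_basis])
  have "mul (e k) (e k) \<noteq> 0 \<longleftrightarrow> k \<le> 3" if "k \<in> {1..n}" for k
    using range[OF that]
    by (elim disjE)
      (use nf basis_nonzero smul_basis_add_nonzero in \<open>simp_all add: normal_form_N5_9_def\<close>)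
  then have "{k\<in>{1..n}. mul (e k) (e k) \<noteq> 0} = {k\<in>{1..n}. k \<le> 3}"
    by blast
  also have "\<dots> = {1..3}"
    unfolding n by auto
  finally show "subspaces_isomorphic (fun_scale smul) (inner_derivations smul mul)
      (*s) (UNIV :: ('k ^ 3) set)"
    by (intro inner_derivations_isomorphic) simp
qed

lemma
  assumes nf: "normal_form_N6_17 smul mul n e \<alpha> \<beta> \<gamma>"
  shows right_mult_N6_17: "right_mult mul (\<Sum>i=1..n. smul (c i) (e i)) =
      fun_scale smul (c 1) (unit_endo smul n e 5 1) +
        fun_scale smul (c 2)
          (fun_scale smul \<alpha> (unit_endo smul n e 5 2) +
           fun_scale smul \<beta> (unit_endo smul n e 6 2)) +
        fun_scale smul (c 3) (fun_scale smul \<gamma> (unit_endo smul n e 6 3)) +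
        fun_scale smul (c 4) (unit_endo smul n e 6 4)" (is "_ = ?d")
    and inner_derivations_N6_17:
      "subspaces_isomorphic (fun_scale smul) (inner_derivations smul mul)
         (*s) (UNIV :: ('k ^ 4) set)"
proof -
  have n: "n = 6"
    using nf by (simp add: normal_form_N6_17_def)
  have range: "k = 1 \<or> k = 2 \<or> k = 3 \<or> k = 4 \<or> k = 5 \<or> k = 6" if "k \<in> {1..n}" for k
    using that unfolding n atLeastAtMost_iff by arith
  note unit_endo = unit_endo_basis[OF natural_basis, unfolded n]
  show "right_mult mul (\<Sum>i=1..n. smul (c i) (e i)) = ?d"
  proof (rule right_mult_eqI)
    show "?d (e k) = smul (c k) (mul (e k) (e k))" if "k \<in> {1..n}" for k
      using range[OF that]
      by (elim disjE)
        (use nf in \<open>simp_all add: normal_form_N6_17_def plus_fun_def fun_scale_def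
          unit_endo scale_right_distrib\<close>)
  qed (intro linear_plus linear_fun_scale linear_unit_endo[OF natural_basis])
  have "mul (e k) (e k) \<noteq> 0 \<longleftrightarrow> k \<le> 4" if "k \<in> {1..n}" for k
    using range[OF that]
    by (elim disjE)
      (use nf basis_nonzero smul_basis_add_nonzero in \<open>simp_all add: normal_form_N6_17_def\<close>)
  then have "{k\<in>{1..n}. mul (e k) (e k) \<noteq> 0} = {k\<in>{1..n}. k \<le> 4}"
    by blast
  also have "\<dots> = {1..4}"
    unfolding n by auto
  finally show "subspaces_isomorphic (fun_scale smul) (inner_derivations smul mul)
      (*s) (UNIV :: ('k ^ 4) set)"
    by (intro inner_derivations_isomorphic) simp
qed

lemma
  assumes nf: "normal_form_N6_18 smul mul n e \<alpha> \<beta> \<gamma> \<delta>"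
  shows right_mult_N6_18: "right_mult mul (\<Sum>i=1..n. smul (c i) (e i)) =
      fun_scale smul (c 1) (unit_endo smul n e 5 1) +
        fun_scale smul (c 2)
          (fun_scale smul \<alpha> (unit_endo smul n e 5 2) +
           fun_scale smul \<beta> (unit_endo smul n e 6 2)) +
        fun_scale smul (c 3)
          (fun_scale smul \<gamma> (unit_endo smul n e 5 3) +
           fun_scale smul \<delta> (unit_endo smul n e 6 3)) +
        fun_scale smul (c 4) (unit_endo smul n e 6 4)" (is "_ = ?d")
    and inner_derivations_N6_18:
      "subspaces_isomorphic (fun_scale smul) (inner_derivations smul mul)
         (*s) (UNIV :: ('k ^ 4) set)"
proof -
  have n: "n = 6"
    using nf by (simp add: normal_form_N6_18_def)
  have range: "k = 1 \<or> k = 2 \<or> k = 3 \<or> k = 4 \<or> k = 5 \<or> k = 6" if "k \<in> {1..n}" for k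
    using that unfolding n atLeastAtMost_iff by arith
  note unit_endo = unit_endo_basis[OF natural_basis, unfolded n]
  show "right_mult mul (\<Sum>i=1..n. smul (c i) (e i)) = ?d"
  proof (rule right_mult_eqI)
    show "?d (e k) = smul (c k) (mul (e k) (e k))" if "k \<in> {1..n}" for k
      using range[OF that]
      by (elim disjE)
        (use nf in \<open>simp_all add: normal_form_N6_18_def plus_fun_def fun_scale_def
          unit_endo scale_right_distrib\<close>)
  qed (intro linear_plus linear_fun_scale linear_unit_endo[OF natural_basis])
  have "mul (e k) (e k) \<noteq> 0 \<longleftrightarrow> k \<le> 4" if "k \<in> {1..n}" for k
    using range[OF that]
    by (elim disjE)
      (use nf basis_nonzero smul_basis_add_nonzero in \<open>simp_all add: normal_form_N6_18_def\<close>)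
  then have "{k\<in>{1..n}. mul (e k) (e k) \<noteq> 0} = {k\<in>{1..n}. k \<le> 4}"
    by blast
  also have "\<dots> = {1..4}"
    unfolding n by auto
  finally show "subspaces_isomorphic (fun_scale smul) (inner_derivations smul mul)
      (*s) (UNIV :: ('k ^ 4) set)"
    by (intro inner_derivations_isomorphic) simp
qed

end

theorem proposition4p2p4:
  fixes smul :: "'k::field \<Rightarrow> 'a::ab_group_add \<Rightarrow> 'a"
    and mul :: "'a \<Rightarrow> 'a \<Rightarrow> 'a"
    and n :: nat and e :: "nat \<Rightarrow> 'a"
  assumes "CHAR('k) \<noteq> 2"
    and "evolution_algebra smul mul"
    and "associative_product mul"
    and "nil_algebra mul"
    and "indecomposable smul mul"
    and "natural_basis smul mul n e" and "n \<le> 6"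
    and "vector_space.dim smul (annihilator mul) = 2"
  shows
    "(\<forall>\<alpha> \<beta>. normal_form_N5_9 smul mul n e \<alpha> \<beta> \<longrightarrow>
        (\<forall>c :: nat \<Rightarrow> 'k.
           right_mult mul (\<Sum>i=1..n. smul (c i) (e i)) \<in> derivations smul mul \<longleftrightarrow>
           right_mult mul (\<Sum>i=1..n. smul (c i) (e i)) =
             fun_scale smul (c 1) (unit_endo smul n e 4 1) +
             fun_scale smul (c 2)
               (fun_scale smul \<alpha> (unit_endo smul n e 4 2) +
                fun_scale smul \<beta> (unit_endo smul n e 5 2)) +
             fun_scale smul (c 3) (unit_endo smul n e 5 3)) \<and>
        subspaces_isomorphic (fun_scale smul) (inner_derivations smul mul)
          (*s) (UNIV :: ('k ^ 3) set)) \<and>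
     (\<forall>\<alpha> \<beta> \<gamma>. normal_form_N6_17 smul mul n e \<alpha> \<beta> \<gamma> \<longrightarrow>
        (\<forall>c :: nat \<Rightarrow> 'k.
           right_mult mul (\<Sum>i=1..n. smul (c i) (e i)) \<in> derivations smul mul \<longleftrightarrow>
           right_mult mul (\<Sum>i=1..n. smul (c i) (e i)) =
             fun_scale smul (c 1) (unit_endo smul n e 5 1) +
             fun_scale smul (c 2)
               (fun_scale smul \<alpha> (unit_endo smul n e 5 2) +
                fun_scale smul \<beta> (unit_endo smul n e 6 2)) +
             fun_scale smul (c 3) (fun_scale smul \<gamma> (unit_endo smul n e 6 3)) +
             fun_scale smul (c 4) (unit_endo smul n e 6 4)) \<and>
        subspaces_isomorphic (fun_scale smul) (inner_derivations smul mul)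
          (*s) (UNIV :: ('k ^ 4) set)) \<and>
     (\<forall>\<alpha> \<beta> \<gamma> \<delta>. normal_form_N6_18 smul mul n e \<alpha> \<beta> \<gamma> \<delta> \<longrightarrow>
        (\<forall>c :: nat \<Rightarrow> 'k.
           right_mult mul (\<Sum>i=1..n. smul (c i) (e i)) \<in> derivations smul mul \<longleftrightarrow>
           right_mult mul (\<Sum>i=1..n. smul (c i) (e i)) =
             fun_scale smul (c 1) (unit_endo smul n e 5 1) +
             fun_scale smul (c 2)
               (fun_scale smul \<alpha> (unit_endo smul n e 5 2) +
                fun_scale smul \<beta> (unit_endo smul n e 6 2)) +
             fun_scale smul (c 3)
               (fun_scale smul \<gamma> (unit_endo smul n e 5 3) +
                fun_scale smul \<delta> (unit_endo smul n e 6 3)) +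
             fun_scale smul (c 4) (unit_endo smul n e 6 4)) \<and>
        subspaces_isomorphic (fun_scale smul) (inner_derivations smul mul)
          (*s) (UNIV :: ('k ^ 4) set))"
proof -
  interpret evolution_algebra smul mul
    by fact
  interpret associative_nil_evolution_algebra smul mul n e
    using assms by unfold_locales
  show ?thesis
    by (intro conjI allI impI iffI)
      (rule right_mult_derivation right_mult_N5_9 inner_derivations_N5_9
        right_mult_N6_17 inner_derivations_N6_17 right_mult_N6_18 inner_derivations_N6_18,
        assumption?)+
qed

end
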